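(* Let $G=T_n\langle t_1,t_2,t_3\rangle$ be a Toeplitz graph not of the form $T_n\langle t_1,2t_1,3t_1\rangle$ (that is, $(t_2,t_3)\ne(2t_1,3t_1)$). Then $G$ is claw-free if and only if $n\le t_2+t_3$ and at least one of the following holds: (i) $t_3=t_1+t_2$; (ii) $t_2=2t_1$, and ($t_3=4t_1$ or $n\le t_1+t_3$); (iii) $t_3=2t_1$ and $n\le\min\{3t_1,2t_2\}$.
   Context: For integers $1\le t_1<t_2<t_3<n$, the Toeplitz graph $T_n\langle t_1,t_2,t_3\rangle$ is the simple graph with vertex set $\{1,\ldots,n\}$ in which $v$ and $w$ are adjacent if and only if $|v-w|\in\{t_1,t_2,t_3\}$. A claw is an induced subgraph isomorphic to $K_{1,3}$; a graph is claw-free if it has no claw. *)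

theory Defs
  imports "Graph_Theory.Graph_Theory"
begin

text \<open>As usual in this library, a simple graph is a symmetric loop-free digraph: an edge joining
  \<open>v\<close> and \<open>w\<close> is the pair of arcs \<open>(v, w)\<close>, \<open>(w, v)\<close>. Integers are used as vertices so that
  \<open>v - w\<close> is a genuine difference.\<close>

definition toeplitz_graph :: "int \<Rightarrow> int \<Rightarrow> int \<Rightarrow> int \<Rightarrow> int pair_pre_digraph" where
  "toeplitz_graph n t1 t2 t3 =
     \<lparr> pverts = {1..n},
       parcs = {(v, w). v \<in> {1..n} \<and> w \<in> {1..n} \<and> \<bar>v - w\<bar> \<in> {t1, t2, t3}} \<rparr>"

text \<open>The predicate \<open>K\<^bsub>1,3\<^esub>\<close> is closed under isomorphism: it holds of every graph with a vertex
  bipartition into parts of sizes 1 and 3 whose edges are all pairs across the parts.\<close>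

definition is_claw :: "('a, 'b) pre_digraph \<Rightarrow> ('a, 'b) pre_digraph \<Rightarrow> bool" where
  "is_claw H G \<longleftrightarrow> induced_subgraph H G \<and> K\<^bsub>1,3\<^esub> H"

definition claw_free :: "('a, 'b) pre_digraph \<Rightarrow> bool" where
  "claw_free G \<longleftrightarrow> \<not> (\<exists>H. is_claw H G)"

text \<open>Well-formedness matters here, since \<^const>\<open>induced_subgraph\<close> is false for an ill-formed
  ambient graph.\<close>

lemma graph_toeplitz_graph:
  assumes "1 \<le> t1" "t1 < t2" "t2 < t3"
  shows "graph (with_proj (toeplitz_graph n t1 t2 t3))"
proof -
  have "finite ({1..n} \<times> {1..n})" by simp
  then have fin: "finite (parcs (toeplitz_graph n t1 t2 t3))"
    by (rule rev_finite_subset) (auto simp: toeplitz_graph_def)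
  interpret pair_graph "toeplitz_graph n t1 t2 t3"
    using assms fin
    by unfold_locales
      (auto simp: toeplitz_graph_def symmetric_def abs_minus_commute intro!: symI)
  show ?thesis by (rule pair_graphD_graph)
qed

end

theory Submission
  imports Defs
begin

text \<open>A claw with centre \<open>v\<close> consists of three neighbours \<open>v + x\<close>, \<open>v + y\<close>, \<open>v + z\<close>, where
  \<open>x\<close>, \<open>y\<close>, \<open>z\<close> are among the six offsets \<open>\<plusminus>t1, \<plusminus>t2, \<plusminus>t3\<close>. Whether the three leaves are pairwise
  non-adjacent depends on their differences only, not on \<open>v\<close>, and since \<open>t3 < n\<close> the configuration
  can be shifted into \<open>{1..n}\<close> exactly when its length \<open>z - x\<close> is less than \<open>n\<close> (for
  \<open>x < y < z\<close>). Hence the graph is claw-free iff every independent triple of offsets has length at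
  least \<open>n\<close> (lemma \<open>claw_free_toeplitz_iff\<close>), which is a finite question about the linear
  relations between \<open>t1\<close>, \<open>t2\<close>, \<open>t3\<close>.

  The triple \<open>t1, t2, t3\<close> always fits, so two of these numbers differ by one of the three. This
  forces \<open>t3 = t1 + t2\<close>, \<open>t2 = 2 * t1\<close>, \<open>t3 = 2 * t1\<close> or \<open>t3 = 2 * t2\<close>. If only the last
  equation holds, the triple \<open>- t1, t1, t2\<close> is independent and too short to be excluded by any
  \<open>n > t3\<close>; in each of the other cases explicit independent triples bound \<open>n\<close> from
  above. Conversely, no independent triple is shorter than these: the given equation makes so many
  pairs of offsets adjacent that any three independent ones lie far apart.\<close>

section \<open>Claws in graphs\<close>

lemma arcs_ends_induced_subgraph:
  assumes "induced_subgraph H G"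
  shows "arcs_ends H = arcs_ends G \<inter> verts H \<times> verts H"
proof -
  have "tail H = tail G" "head H = head G"
    using assms by (auto simp: induced_subgraph_def subgraph_def compatible_def)
  moreover have "arcs H = {e \<in> arcs G. tail G e \<in> verts H \<and> head G e \<in> verts H}"
    using assms by (auto simp: induced_subgraph_def)
  ultimately show ?thesis
    by (auto simp: arcs_ends_conv)
qed

text \<open>This replaces the subgraph \<open>H\<close> by its vertices: a centre and an independent set of three
  neighbours. In the direction from right to left the witness is the subgraph induced by these four
  vertices; the centre is not among its own neighbours because a graph has no loops.\<close>

lemma ex_claw_iff:
  assumes "graph G"
  shows "(\<exists>H. is_claw H G) \<longleftrightarrow>
    (\<exists>v A. card A = 3 \<and> (\<forall>x\<in>A. (v, x) \<in> arcs_ends G) \<and> (\<forall>x\<in>A. \<forall>y\<in>A. (x, y) \<notin> arcs_ends G))"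
    (is "?L \<longleftrightarrow> ?R")
proof
  assume ?L
  then obtain H where H: "induced_subgraph H G" and "K\<^bsub>1,3\<^esub> H"
    unfolding is_claw_def by blast
  then obtain U A where UA: "verts H = U \<union> A" "U \<inter> A = {}" "card U = 1" "card A = 3"
      and arcs: "arcs_ends H = U \<times> A \<union> A \<times> U"
    unfolding complete_bipartite_digraph_def by blast
  obtain v where U: "U = {v}"
    using UA(3) card_1_singletonE by blast
  have "v \<notin> A"
    using UA(2) U by simp
  have arc_iff: "(x, y) \<in> arcs_ends G \<longleftrightarrow> (x, y) \<in> {v} \<times> A \<union> A \<times> {v}"
    if "x \<in> insert v A" "y \<in> insert v A" for x y
  proof -
    have "(x, y) \<in> arcs_ends H \<longleftrightarrow> (x, y) \<in> arcs_ends G"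
      using that UA(1) U unfolding arcs_ends_induced_subgraph[OF H] by auto
    then show ?thesis
      unfolding arcs U by simp
  qed
  have "\<forall>x\<in>A. (v, x) \<in> arcs_ends G" "\<forall>x\<in>A. \<forall>y\<in>A. (x, y) \<notin> arcs_ends G"
    using arc_iff \<open>v \<notin> A\<close> by auto
  with UA(4) show ?R
    by blast
next
  assume ?R
  then obtain v A where card: "card A = 3"
    and adj: "\<And>x. x \<in> A \<Longrightarrow> (v, x) \<in> arcs_ends G"
    and indep: "\<And>x y. x \<in> A \<Longrightarrow> y \<in> A \<Longrightarrow> (x, y) \<notin> arcs_ends G"
    by blast
  interpret graph G by fact
  have adj': "(x, v) \<in> arcs_ends G" if "x \<in> A" for x
    using adj[OF that] by (auto intro: graph_symmetric)
  have "A \<noteq> {}" using card by auto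
  have "v \<notin> A" using adj indep by blast
  have sub: "insert v A \<subseteq> verts G"
    using adj \<open>A \<noteq> {}\<close> adj_in_verts by blast
  have loop: "(v, v) \<notin> arcs_ends G"
    using adj_not_same by blast
  have H: "induced_subgraph (G \<restriction> insert v A) G"
    using sub by auto
  have "arcs_ends (G \<restriction> insert v A) = {v} \<times> A \<union> A \<times> {v}"
  proof -
    have "{v} \<times> A \<subseteq> arcs_ends G" "A \<times> {v} \<subseteq> arcs_ends G" "A \<times> A \<inter> arcs_ends G = {}"
      using adj adj' indep by auto
    with loop show ?thesis
      unfolding arcs_ends_induced_subgraph[OF H] induce_subgraph_verts by blast
  qed
  moreover have "graph (G \<restriction> insert v A)"
    using digraphI_induced[OF H] induced_graph_imp_graph[OF H]
    by (simp add: graph_def pseudo_graph_def digraph_def)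
  moreover have "verts (G \<restriction> insert v A) = {v} \<union> A" "{v} \<inter> A = {}" "card {v} = 1"
    using \<open>v \<notin> A\<close> by simp_all
  ultimately have "K\<^bsub>1,3\<^esub> (G \<restriction> insert v A)"
    unfolding complete_bipartite_digraph_def using card by blast
  with H show ?L
    unfolding is_claw_def by blast
qed

section \<open>Reduction to offsets\<close>

text \<open>The positions of the leaves relative to the centre. Listing them in increasing order keeps the
  three differences positive, so that they can be compared with \<open>D\<close> directly.\<close>

definition claw_offsets :: "int set \<Rightarrow> int \<Rightarrow> int \<Rightarrow> int \<Rightarrow> bool" where
  "claw_offsets D x y z \<longleftrightarrow>
    {\<bar>x\<bar>, \<bar>y\<bar>, \<bar>z\<bar>} \<subseteq> D \<and> x < y \<and> y < z \<and> {y - x, z - y, z - x} \<inter> D = {}"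

lemma card_3_sorted:
  fixes A :: "'a::linorder set"
  assumes "card A = 3"
  obtains x y z where "A = {x, y, z}" "x < y" "y < z"
proof -
  obtain a b c where "A = {a, b, c}" "a \<noteq> b" "b \<noteq> c" "a \<noteq> c"
    using assms by (auto simp: card_3_iff)
  then show thesis
    using that[of a b c] that[of a c b] that[of b a c] that[of b c a] that[of c a b] that[of c b a]
    by (auto simp: insert_commute neq_iff)
qed

text \<open>Subtracting the centre of a claw from its leaves gives offsets of length less than \<open>n\<close>.
  Conversely, as every offset is at most \<open>t3 < n\<close> in absolute value, including the centre among the
  vertices does not make the configuration longer than \<open>{1..n}\<close>: either it lies between the outer
  leaves, or all leaves are within \<open>t3\<close> on one side of it.\<close>

lemma claw_free_toeplitz_iff:
  assumes "1 \<le> t1" "t1 < t2" "t2 < t3" "t3 < n"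
  shows "claw_free (with_proj (toeplitz_graph n t1 t2 t3)) \<longleftrightarrow>
    (\<forall>x y z. claw_offsets {t1, t2, t3} x y z \<longrightarrow> n \<le> z - x)"
proof -
  let ?G = "with_proj (toeplitz_graph n t1 t2 t3)"
  let ?D = "{t1, t2, t3}"
  have arc: "(v, w) \<in> arcs_ends ?G \<longleftrightarrow> v \<in> {1..n} \<and> w \<in> {1..n} \<and> \<bar>v - w\<bar> \<in> ?D" for v w
    by (simp add: toeplitz_graph_def)
  have "(\<exists>H. is_claw H ?G) \<longleftrightarrow> (\<exists>x y z. claw_offsets ?D x y z \<and> z - x < n)" (is "?L \<longleftrightarrow> ?R")
  proof
    assume ?L
    then obtain v A where "card A = 3" and adj: "\<And>x. x \<in> A \<Longrightarrow> (v, x) \<in> arcs_ends ?G"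
      and indep: "\<And>x y. x \<in> A \<Longrightarrow> y \<in> A \<Longrightarrow> (x, y) \<notin> arcs_ends ?G"
      unfolding ex_claw_iff[OF graph_toeplitz_graph[OF assms(1-3)]] by blast
    then obtain x y z where A: "A = {x, y, z}" "x < y" "y < z"
      using card_3_sorted by metis
    have in_D: "\<bar>v - x\<bar> \<in> ?D" "\<bar>v - y\<bar> \<in> ?D" "\<bar>v - z\<bar> \<in> ?D"
      and range: "x \<in> {1..n}" "y \<in> {1..n}" "z \<in> {1..n}"
      using adj A(1) unfolding arc by auto
    have "\<bar>y - x\<bar> \<notin> ?D" "\<bar>z - y\<bar> \<notin> ?D" "\<bar>z - x\<bar> \<notin> ?D"
      using indep A(1) range unfolding arc by blast+
    with in_D A(2,3) have "claw_offsets ?D (x - v) (y - v) (z - v)"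
      unfolding claw_offsets_def by (simp add: abs_minus_commute)
    with range show ?R
      by (intro exI[of _ "x - v"] exI[of _ "y - v"] exI[of _ "z - v"]) auto
  next
    assume ?R
    then obtain x y z where xyz: "claw_offsets ?D x y z" "z - x < n"
      by blast
    then have ord: "x < y" "y < z" and in_D: "\<bar>x\<bar> \<in> ?D" "\<bar>y\<bar> \<in> ?D" "\<bar>z\<bar> \<in> ?D"
      and diff: "y - x \<notin> ?D" "z - y \<notin> ?D" "z - x \<notin> ?D"
      by (auto simp: claw_offsets_def)
    \<comment> \<open>The leftmost position: the least of the four vertices becomes \<open>1\<close>.\<close>
    define v where "v = 1 + max 0 (- x)"
    have "\<bar>x\<bar> < n" "\<bar>z\<bar> < n"
      using in_D assms by auto
    then have range: "v \<in> {1..n}" "v + x \<in> {1..n}" "v + y \<in> {1..n}" "v + z \<in> {1..n}"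
      using ord xyz(2) by (auto simp: v_def)
    have "card {v + x, v + y, v + z} = 3"
      using ord by simp
    moreover have "\<forall>w\<in>{v + x, v + y, v + z}. (v, w) \<in> arcs_ends ?G"
      using in_D range unfolding arc by simp
    moreover have "(w, w') \<notin> arcs_ends ?G"
      if "w \<in> {v + x, v + y, v + z}" "w' \<in> {v + x, v + y, v + z}" for w w'
    proof -
      have "\<bar>w - w'\<bar> \<in> {0, y - x, z - y, z - x}"
        using that ord by auto
      moreover have "0 \<notin> ?D"
        using assms by simp
      ultimately have "\<bar>w - w'\<bar> \<notin> ?D"
        using diff by fastforce
      then show ?thesis
        unfolding arc by simp
    qed
    ultimately show ?L
      unfolding ex_claw_iff[OF graph_toeplitz_graph[OF assms(1-3)]] by blast
  qed
  then show ?thesis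
    unfolding claw_free_def by (auto simp: not_less)
qed

section \<open>Arithmetic of independent offsets\<close>

lemma claw_offsetsD:
  assumes "claw_offsets D x y z"
  shows "\<bar>x\<bar> \<in> D" "\<bar>y\<bar> \<in> D" "\<bar>z\<bar> \<in> D" "x < y" "y < z" "y - x \<notin> D" "z - y \<notin> D" "z - x \<notin> D"
  using assms by (auto simp: claw_offsets_def)

text \<open>The next four lemmas bound the length of an independent triple from below. Reflection at the
  centre turns \<open>x, y, z\<close> into \<open>- z, - y, - x\<close>, so the arguments may assume that at least two offsets
  are positive.

  If \<open>t3 = t1 + t2\<close>, then \<open>t3\<close> is adjacent to \<open>t1\<close> and to \<open>t2\<close>, so exactly two offsets are
  positive, namely \<open>t1\<close> and \<open>t2\<close>. The third is neither \<open>- t1\<close> nor \<open>- t2\<close>, which are adjacent to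
  \<open>t2\<close> and \<open>t1\<close> respectively, and \<open>- t3\<close> gives length \<open>t2 + t3\<close>.\<close>

lemma claw_offsets_length_sum:
  assumes "0 < t1" "t1 < t2" "t3 = t1 + t2" "claw_offsets {t1, t2, t3} x y z"
  shows "t2 + t3 \<le> z - x"
  using assms(1-3) claw_offsetsD[OF assms(4)] by (simp, smt (verit))

text \<open>Here \<open>t2\<close> is adjacent to \<open>t1\<close> and to \<open>t3\<close>, so the positive offsets are \<open>t1\<close> and \<open>t3\<close>. The
  third is not \<open>- t1\<close>, at distance \<open>t2\<close> from \<open>t1\<close>, hence at most \<open>- t2\<close>.\<close>

lemma claw_offsets_length_double_quadruple:
  assumes "0 < t1" "t2 = 2 * t1" "t3 = 4 * t1" "claw_offsets {t1, t2, t3} x y z"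
  shows "t2 + t3 \<le> z - x"
  using assms(1-3) claw_offsetsD[OF assms(4)] by (simp, smt (verit))

text \<open>As \<open>t1\<close> and \<open>t2\<close> are adjacent, the positive offsets are \<open>t3\<close> and one other, and the remaining
  offset is at most \<open>- t1\<close>.\<close>

lemma claw_offsets_length_double:
  assumes "0 < t1" "t2 = 2 * t1" "t2 < t3" "claw_offsets {t1, t2, t3} x y z"
  shows "t1 + t3 \<le> z - x"
  using assms(1-3) claw_offsetsD[OF assms(4)] by (simp, smt (verit))

text \<open>As \<open>t1\<close> and \<open>t3\<close> are adjacent, some offset is negative. If \<open>t3\<close> occurs, the length is at
  least \<open>t1 + t3 = 3 * t1\<close>. Otherwise \<open>t1\<close> and \<open>t2\<close> occur; the negative offset is not \<open>- t1\<close>, at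
  distance \<open>t3\<close> from \<open>t1\<close>, and the length is at least \<open>2 * t2\<close>.\<close>

lemma claw_offsets_length_half:
  assumes "0 < t1" "t1 < t2" "t2 < t3" "t3 = 2 * t1" "claw_offsets {t1, t2, t3} x y z"
  shows "3 * t1 \<le> z - x \<or> 2 * t2 \<le> z - x"
  using assms(1-4) claw_offsetsD[OF assms(5)] by (simp, smt (verit))

theorem theorem4p6:
  fixes n t1 t2 t3 :: int
  assumes "1 \<le> t1" and "t1 < t2" and "t2 < t3" and "t3 < n"
    and "(t2, t3) \<noteq> (2 * t1, 3 * t1)"
  shows "claw_free (with_proj (toeplitz_graph n t1 t2 t3)) \<longleftrightarrow>
    n \<le> t2 + t3 \<and>
    (t3 = t1 + t2 \<or>
     t2 = 2 * t1 \<and> (t3 = 4 * t1 \<or> n \<le> t1 + t3) \<or>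
     t3 = 2 * t1 \<and> n \<le> min (3 * t1) (2 * t2))"
    (is "_ \<longleftrightarrow> ?R")
proof -
  let ?D = "{t1, t2, t3}"
  have not3: "\<not> (t2 = 2 * t1 \<and> t3 = 3 * t1)"
    using assms(5) by simp
  have "(\<forall>x y z. claw_offsets ?D x y z \<longrightarrow> n \<le> z - x) \<longleftrightarrow> ?R"
  proof
    assume long: "\<forall>x y z. claw_offsets ?D x y z \<longrightarrow> n \<le> z - x"
    have short: "\<not> claw_offsets ?D x y z" if "z - x < n" for x y z
      using long that by force
    \<comment> \<open>Some difference of \<open>t1\<close>, \<open>t2\<close>, \<open>t3\<close> lies in \<open>?D\<close>; only these coincidences are possible.\<close>
    have "\<not> claw_offsets ?D t1 t2 t3"
      using assms by (intro short) simp
    then consider (sum) "t3 = t1 + t2" | (double) "t2 = 2 * t1" "t3 \<noteq> t1 + t2"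
      | (half) "t3 = 2 * t1" | (double2) "t3 = 2 * t2" "t2 \<noteq> 2 * t1"
      using assms by (auto simp: claw_offsets_def)
    then show ?R
    proof cases
      case sum
      \<comment> \<open>\<open>t1\<close> and \<open>t2\<close> would be adjacent if \<open>t2 = 2 * t1\<close>, but then \<open>t3 = 3 * t1\<close>.\<close>
      have "claw_offsets ?D (- t3) t1 t2"
        using sum assms not3 by (auto simp: claw_offsets_def)
      with long sum show ?thesis by force
    next
      case double
      show ?thesis
      proof (cases "t3 = 4 * t1")
        case True
        have "claw_offsets ?D (- t2) t1 t3"
          using double True assms by (auto simp: claw_offsets_def)
        with long double True show ?thesis by force
      next
        case False
        \<comment> \<open>The distances are \<open>3 * t1\<close>, \<open>t3 - 2 * t1\<close> and \<open>t1 + t3\<close>; only \<open>t3 = 3 * t1\<close> or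
          \<open>t3 = 4 * t1\<close> would put one of them into \<open>?D\<close>.\<close>
        have "claw_offsets ?D (- t1) t2 t3"
          using double False assms by (auto simp: claw_offsets_def)
        with long have "n \<le> t1 + t3" by force
        with double assms show ?thesis by auto
      qed
    next
      case half
      have "claw_offsets ?D (- t1) t2 t3" "claw_offsets ?D (- t2) t1 t2"
        using half assms by (auto simp: claw_offsets_def)
      with long have "n \<le> t1 + t3" "n \<le> 2 * t2" by force+
      with half assms show ?thesis by auto
    next
      case double2
      \<comment> \<open>This claw has length \<open>t1 + t2 < 2 * t2 = t3 < n\<close>, so the case is contradictory.\<close>
      have "claw_offsets ?D (- t1) t1 t2"
        using double2 assms by (auto simp: claw_offsets_def)
      with short[of t2 "- t1"] double2 assms show ?thesis by auto
    qed
  next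
    assume R: ?R
    show "\<forall>x y z. claw_offsets ?D x y z \<longrightarrow> n \<le> z - x"
    proof (intro allI impI)
      fix x y z
      assume xyz: "claw_offsets ?D x y z"
      have "0 < t1" using assms by simp
      from R consider (sum) "t3 = t1 + t2" "n \<le> t2 + t3"
        | (quadruple) "t2 = 2 * t1" "t3 = 4 * t1" "n \<le> t2 + t3"
        | (double) "t2 = 2 * t1" "n \<le> t1 + t3"
        | (half) "t3 = 2 * t1" "n \<le> 3 * t1" "n \<le> 2 * t2"
        by auto
      then show "n \<le> z - x"
      proof cases
        case sum
        with claw_offsets_length_sum[OF \<open>0 < t1\<close> assms(2) _ xyz] show ?thesis by simp
      next
        case quadruple
        with claw_offsets_length_double_quadruple[OF \<open>0 < t1\<close> _ _ xyz] show ?thesis by simp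
      next
        case double
        with claw_offsets_length_double[OF \<open>0 < t1\<close> _ assms(3) xyz] show ?thesis by simp
      next
        case half
        with claw_offsets_length_half[OF \<open>0 < t1\<close> assms(2,3) _ xyz] show ?thesis by auto
      qed
    qed
  qed
  then show ?thesis
    using claw_free_toeplitz_iff[OF assms(1-4)] by simp
qed

end
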